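(* Let $D$ be a strongly connected balanced bipartite digraph of order $2a\geq 8$ with partite sets $X$ and $Y$. If $D$ contains a cycle of length $2a-2$ and $\max\{d(x),d(y)\}\geq 2a-2$ for every dominating pair of vertices $\{x,y\}$ of $D$, then $D$ contains a cycle of length $2k$ for every integer $k$ with $1\leq k\leq a-1$.
   Context: All digraphs are finite, without loops and without multiple arcs (but both arcs $xy$ and $yx$ may be present). A digraph $D$ is bipartite if its vertex set has a partition into two partite sets $X,Y$ such that every arc has its end-vertices in different partite sets; it is balanced if $|X|=|Y|$. The order of $D$ is its number of vertices. $D$ is strongly connected if for every pair of distinct vertices $x,y$ there are a directed path from $x$ to $y$ and a directed path from $y$ to $x$. Write $x\rightarrow z$ if $xz$ is an arc of $D$. A pair $\{x,y\}$ of distinct vertices is a dominating pair if there is a vertex $z$ with $x\rightarrow z$ and $y\rightarrow z$. The degree of $x$ is $d(x)=d^+(x)+d^-(x)$, the sum of the out-degree and the in-degree of $x$ in $D$. A cycle means a directed cycle $x_1x_2\cdots x_mx_1$ with distinct vertices $x_1,\dots,x_m$, $m\geq 2$; its length is its number $m$ of arcs. In particular a pair of opposite arcs $xy,yx$ forms a cycle of length $2$. *)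

theory Defs
  imports "Graph_Theory.Graph_Theory"
begin

definition bipartition :: "('a, 'b) pre_digraph \<Rightarrow> 'a set \<Rightarrow> 'a set \<Rightarrow> bool" where
  "bipartition D X Y \<longleftrightarrow>
     X \<union> Y = verts D \<and> X \<inter> Y = {} \<and>
     (\<forall>e \<in> arcs D. (tail D e \<in> X \<and> head D e \<in> Y) \<or> (tail D e \<in> Y \<and> head D e \<in> X))"

definition balanced_bipartition :: "('a, 'b) pre_digraph \<Rightarrow> 'a set \<Rightarrow> 'a set \<Rightarrow> bool" where
  "balanced_bipartition D X Y \<longleftrightarrow> bipartition D X Y \<and> card X = card Y"

definition dominating_pair :: "('a, 'b) pre_digraph \<Rightarrow> 'a \<Rightarrow> 'a \<Rightarrow> bool" where
  "dominating_pair D x y \<longleftrightarrow>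
     x \<in> verts D \<and> y \<in> verts D \<and> x \<noteq> y \<and>
     (\<exists>z \<in> verts D. x \<rightarrow>\<^bsub>D\<^esub> z \<and> y \<rightarrow>\<^bsub>D\<^esub> z)"

definition degree :: "('a, 'b) pre_digraph \<Rightarrow> 'a \<Rightarrow> nat" where
  "degree D v = out_degree D v + in_degree D v"

text \<open>
  A cycle of the library is a nonempty closed list of arcs without repeated vertices; the length
  of the list is the number of arcs. In a loopfree digraph it is at least 2, and a pair of
  opposite arcs is a cycle of length 2.
\<close>

definition has_cycle_of_length :: "('a, 'b) pre_digraph \<Rightarrow> nat \<Rightarrow> bool" where
  "has_cycle_of_length D m \<longleftrightarrow> (\<exists>p. pre_digraph.cycle D p \<and> length p = m)"

end

theory Submission
  imports Defs
begin

text \<open>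
  Call a vertex rich if its degree is at least \<open>2 * a - 2\<close>. A rich vertex misses at most two of the
  \<open>2 * a\<close> arcs that join it to the opposite part, so among three disjoint pairs consisting of a
  possible out-arc and a possible in-arc at it, some pair is present. On the cycle \<open>C\<close> of length
  \<open>2 * a - 2\<close>, such a pair cuts off a cycle of any wanted length.

  Three such pairs are always available at a rich vertex outside \<open>C\<close>, so both vertices outside
  \<open>C\<close> may be assumed poor. They are also available at a rich vertex of \<open>C\<close>, except for the length
  \<open>2 * a - 4\<close>, where the third pair consists of the two arcs joining it to the outside vertex \<open>q\<close> of
  the opposite part. If the length \<open>2 * a - 4\<close> is missing, every rich vertex of \<open>C\<close> is therefore
  joined to \<open>q\<close> in both directions. As \<open>q\<close> is poor, every cycle vertex whose successor is dominated
  by \<open>q\<close> is rich. Starting from an arc that enters \<open>C\<close>, this propagates backwards around \<open>C\<close> until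
  an outside vertex has enough arcs to close a cycle of length \<open>2 * a - 4\<close>.
\<close>

section \<open>Cycles as vertex sequences\<close>

lemma awalk_of_function:
  assumes "wf_digraph D" and "\<And>i. i < k \<Longrightarrow> g i \<rightarrow>\<^bsub>D\<^esub> g (Suc i)" and "g 0 \<in> verts D"
  shows "\<exists>p. pre_digraph.awalk D (g 0) p (g k) \<and> pre_digraph.awalk_verts D (g 0) p = map g [0..<Suc k]"
  using assms(2)
proof (induction k)
  case 0
  interpret wf_digraph D by fact
  show ?case
    using assms(3) by (intro exI[of _ "[]"]) (auto simp: awalk_def)
next
  case (Suc k)
  interpret wf_digraph D by fact
  obtain p where p: "awalk (g 0) p (g k)" "awalk_verts (g 0) p = map g [0..<Suc k]"
    using Suc by auto
  obtain e where e: "e \<in> arcs D" "tail D e = g k" "head D e = g (Suc k)"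
    using Suc.prems[of k] by auto
  have *: "awalk (g k) [e] (g (Suc k))"
    using e adj_in_verts(1)[OF Suc.prems[of k]] by (auto simp: awalk_def)
  have w: "awalk (g 0) (p @ [e]) (g (Suc k))"
    using p(1) * by (rule awalk_appendI)
  moreover have "awalk_verts (g 0) (p @ [e]) = map g [0..<Suc (Suc k)]"
    using awalk_verts_append[OF w] p e by simp
  ultimately show ?case by blast
qed

lemma has_cycle_of_lengthI:
  assumes "wf_digraph D" and "\<And>i. i < k \<Longrightarrow> g i \<rightarrow>\<^bsub>D\<^esub> g (Suc i)" and "inj_on g {..<k}"
    and "g k = g 0" and "k > 0"
  shows "has_cycle_of_length D k"
proof -
  interpret wf_digraph D by fact
  have "g 0 \<in> verts D"
    using assms(2)[of 0] assms(5) adj_in_verts by blast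
  then obtain p where p: "awalk (g 0) p (g k)" "awalk_verts (g 0) p = map g [0..<Suc k]"
    using awalk_of_function[of D k g] assms by blast
  have "Suc (length p) = length (map g [0..<Suc k])"
    unfolding p(2)[symmetric] length_awalk_verts ..
  then have len: "length p = k" by simp
  \<comment> \<open>A library cycle drops the first vertex before asking for distinctness, so
    injectivity is moved from 0..k-1 to 1..k by replacing the index \<open>k\<close> with 0.\<close>
  have "inj_on g {Suc 0..<Suc k}"
  proof (rule inj_onI)
    fix i j assume "i \<in> {Suc 0..<Suc k}" "j \<in> {Suc 0..<Suc k}" "g i = g j"
    moreover have "g i = g (if i = k then 0 else i)" "g j = g (if j = k then 0 else j)"
      using assms(4) by auto
    ultimately have "(if i = k then 0 else i) = (if j = k then 0 else j)"
      using assms(3,5) by (intro inj_onD[OF assms(3)]) (auto split: if_splits)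
    then show "i = j" using \<open>i \<in> _\<close> \<open>j \<in> _\<close> by (auto split: if_splits)
  qed
  moreover have "tl (map g [0..<Suc k]) = map g [Suc 0..<Suc k]"
    by (simp add: upt_conv_Cons del: upt_Suc)
  ultimately have "distinct (tl (awalk_verts (g 0) p))"
    unfolding p(2) by (simp add: distinct_map del: upt_Suc)
  then show ?thesis
    using p(1) assms(4,5) len unfolding has_cycle_of_length_def cycle_def by auto
qed

text \<open>Indexing by all natural numbers, with period \<open>k\<close>, lets segments run past
  the end of the cycle without wrap-around cases.\<close>

lemma has_cycle_of_lengthE:
  assumes "wf_digraph D" and "has_cycle_of_length D k"
  obtains v :: "nat \<Rightarrow> 'a" where "\<And>i. v i \<rightarrow>\<^bsub>D\<^esub> v (Suc i)" "\<And>i j. v i = v j \<longleftrightarrow> i mod k = j mod k"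
proof -
  interpret wf_digraph D by fact
  obtain p u where p: "awalk u p u" "distinct (tl (awalk_verts u p))" "p \<noteq> []" "length p = k"
    using assms(2) unfolding has_cycle_of_length_def cycle_def by blast
  define v where "v i = head D (p ! (i mod k))" for i
  have k: "k > 0" using p by auto
  have cas: "cas u p u" and arcs: "set p \<subseteq> arcs D" using p(1) by (auto simp: awalk_def)
  have dist: "distinct (map (head D) p)"
    using p(2,3) awalk_verts_conv'[OF cas] by simp
  \<comment> \<open>Both sides list the vertices of the walk. As it is closed, the tails are the
    heads rotated by one place, which makes consecutive \<open>v i\<close> adjacent.\<close>
  have "map (tail D) p @ [head D (last p)] = tail D (hd p) # map (head D) p"
    using awalk_verts_conv'[OF cas] awalk_verts_conv[of u p] p(3) by simp
  moreover have "tail D (hd p) = head D (last p)"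
    using awhd_of_awalk[OF p(1)] awlast_of_awalk[OF p(1)] awalk_verts_conv'[OF cas] p(3)
    by (simp add: last_map)
  ultimately have shift: "map (tail D) p @ [head D (last p)] = head D (last p) # map (head D) p"
    by simp
  have step: "v i \<rightarrow>\<^bsub>D\<^esub> v (Suc i)" for i
  proof -
    let ?j = "Suc i mod k"
    have j: "?j < k" using k by simp
    have "tail D (p ! ?j) = (map (tail D) p @ [head D (last p)]) ! ?j"
      using j p(4) by (simp add: nth_append)
    also have "\<dots> = v i"
      unfolding shift using k p(3,4)
      by (auto simp: v_def mod_Suc last_conv_nth intro!: arg_cong[of _ _ "\<lambda>l. head D (p ! l)"])
    finally have "tail D (p ! ?j) = v i" .
    moreover have "p ! ?j \<in> arcs D" using arcs j p(4) by auto
    ultimately show ?thesis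
      unfolding v_def arcs_ends_conv by force
  qed
  have "v i = v j \<longleftrightarrow> i mod k = j mod k" for i j
    using nth_eq_iff_index_eq[OF dist, of "i mod k" "j mod k"] k p(4) by (simp add: v_def)
  with step show ?thesis by (rule that)
qed

section \<open>Partite sets and positions on the long cycle\<close>

locale bipartite_with_cycle = digraph D for D :: "('a, 'b) pre_digraph" (structure) +
  fixes X Y :: "'a set" and a :: nat and v :: "nat \<Rightarrow> 'a"
  assumes bal: "balanced_bipartition D X Y"
    and card_verts: "card (verts D) = 2 * a"
    and a_ge: "a \<ge> 4"
    and v_arc: "v i \<rightarrow>\<^bsub>D\<^esub> v (Suc i)"
    and v_eq_iff: "v i = v j \<longleftrightarrow> i mod (2 * a - 2) = j mod (2 * a - 2)"
    and dom: "dominating_pair D x y \<Longrightarrow> max (degree D x) (degree D y) \<ge> 2 * a - 2"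
begin

definition rich :: "'a \<Rightarrow> bool" where
  "rich u \<longleftrightarrow> degree D u \<ge> 2 * a - 2"

definition opp :: "'a \<Rightarrow> 'a set" where
  "opp u = {w \<in> verts D. (w \<in> X) \<noteq> (u \<in> X)}"

lemma arc_opp: "u \<rightarrow>\<^bsub>D\<^esub> w \<Longrightarrow> w \<in> opp u" "u \<rightarrow>\<^bsub>D\<^esub> w \<Longrightarrow> u \<in> opp w"
  using bal unfolding opp_def balanced_bipartition_def bipartition_def arcs_ends_conv by auto

lemma finite_opp: "finite (opp u)"
  unfolding opp_def by simp

lemma parts: "finite X" "finite Y" "card X = a" "card Y = a" "verts D = X \<union> Y" "X \<inter> Y = {}"
proof -
  show *: "verts D = X \<union> Y" "X \<inter> Y = {}"
    using bal unfolding balanced_bipartition_def bipartition_def by auto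
  show f: "finite X" "finite Y" using * finite_verts by auto
  show "card X = a" "card Y = a"
    using card_Un_disjoint[OF f *(2)] bal card_verts *(1) unfolding balanced_bipartition_def by auto
qed

lemma card_opp: "card (opp u) = a"
proof -
  have "opp u = (if u \<in> X then Y else X)"
    unfolding opp_def using parts(5,6) by auto
  then show ?thesis using parts by simp
qed

lemma v_in_verts [simp]: "v i \<in> verts D"
  using adj_in_verts[OF v_arc] by simp

lemma v_Suc_opp: "v (Suc i) \<in> opp u \<longleftrightarrow> v i \<notin> opp u"
  using arc_opp(1)[OF v_arc[of i]] unfolding opp_def by auto

lemma v_even_opp: "v (i + 2 * j) \<in> opp u \<longleftrightarrow> v i \<in> opp u"
  by (induction j) (auto simp: v_Suc_opp)

lemma v_neq: "i < j \<Longrightarrow> j < i + (2 * a - 2) \<Longrightarrow> v i \<noteq> v j"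
proof
  assume ij: "i < j" "j < i + (2 * a - 2)" and "v i = v j"
  then have "(2 * a - 2) dvd (j - i)"
    unfolding v_eq_iff by (metis less_or_eq_imp_le mod_eq_dvd_iff_nat)
  then show False
    using ij by (auto dest: dvd_imp_le)
qed

lemma inj_on_v: "k \<le> 2 * a - 2 \<Longrightarrow> inj_on v {s..<s + k}"
proof (rule inj_onI)
  fix i j assume "k \<le> 2 * a - 2" "i \<in> {s..<s + k}" "j \<in> {s..<s + k}" "v i = v j"
  then show "i = j"
    using v_neq[of i j] v_neq[of j i] by (cases i j rule: linorder_cases) auto
qed

text \<open>The three positions lie among six consecutive ones, and \<open>a \<ge> 4\<close> gives 6
  \<le> 2a - 2.\<close>

lemma inj_on_v_even: "inj_on (\<lambda>i. v (s + 2 * i)) {..<3}"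
proof (rule inj_onI)
  fix i j :: nat assume "i \<in> {..<3}" "j \<in> {..<3}" "v (s + 2 * i) = v (s + 2 * j)"
  then have "s + 2 * i = s + 2 * j"
    using a_ge by (intro inj_onD[OF inj_on_v[of 6 s]]) auto
  then show "i = j" by simp
qed

section \<open>Counting missing arcs at a rich vertex\<close>

lemma rich_pair:
  fixes f g :: "nat \<Rightarrow> 'a"
  assumes rich: "rich u"
    and f: "inj_on f {..<3}" "f ` {..<3} \<subseteq> opp u"
    and g: "inj_on g {..<3}" "g ` {..<3} \<subseteq> opp u"
  obtains i where "i < 3" "u \<rightarrow>\<^bsub>D\<^esub> f i" "g i \<rightarrow>\<^bsub>D\<^esub> u"
proof (rule ccontr)
  assume "\<not> thesis"
  then have miss: "\<not> (u \<rightarrow>\<^bsub>D\<^esub> f i \<and> g i \<rightarrow>\<^bsub>D\<^esub> u)" if "i < 3" for i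
    using that \<open>\<And>i. \<lbrakk>i < 3; u \<rightarrow>\<^bsub>D\<^esub> f i; g i \<rightarrow>\<^bsub>D\<^esub> u\<rbrakk> \<Longrightarrow> thesis\<close> by blast
  \<comment> \<open>Each index is charged to one missing arc: an out-arc if it is in
    \<open>I\<close>, otherwise an in-arc. Three arcs are then missing, so the degree is at most 2a
    - 3.\<close>
  define I where "I = {i \<in> {..<3}. \<not> u \<rightarrow>\<^bsub>D\<^esub> f i}"
  define J where "J = {..<3} - I"
  have IJ: "I \<subseteq> {..<3}" "J \<subseteq> {..<3}" 
    unfolding J_def I_def by auto
  then have fin: "finite I" "finite J" using finite_subset by blast+
  have cIJ: "card I + card J = 3"
    using card_Un_disjoint[OF fin] IJ unfolding J_def by (simp add: Un_absorb1)
  have cf: "card (f ` I) = card I" and cg: "card (g ` J) = card J"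
    using IJ f(1) g(1) by (auto intro!: card_image intro: inj_on_subset)
  \<comment> \<open>Without parallel arcs, degrees count neighbours.\<close>
  have "inj_on (head D) (out_arcs D u)" "inj_on (tail D) (in_arcs D u)"
    by (auto intro!: inj_onI no_multi_arcs simp: arc_to_ends_def)
  then have deg: "out_degree D u = card (head D ` out_arcs D u)"
      "in_degree D u = card (tail D ` in_arcs D u)"
    unfolding out_degree_def in_degree_def by (simp_all add: card_image)
  have "head D ` out_arcs D u \<subseteq> opp u - f ` I"
  proof safe
    fix e assume e: "e \<in> out_arcs D u"
    then have ue: "u \<rightarrow>\<^bsub>D\<^esub> head D e" unfolding arcs_ends_conv by force
    show "head D e \<in> opp u" using arc_opp(1)[OF ue] .
    fix i assume "head D e = f i" "i \<in> I"
    with ue show False unfolding I_def by simp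
  qed
  then have "out_degree D u \<le> card (opp u - f ` I)"
    unfolding deg by (intro card_mono) (auto simp: finite_opp)
  also have "\<dots> = a - card I"
    using f(2) IJ fin by (subst card_Diff_subset) (auto simp: card_opp cf)
  finally have o: "out_degree D u \<le> a - card I" .
  have "tail D ` in_arcs D u \<subseteq> opp u - g ` J"
  proof safe
    fix e assume e: "e \<in> in_arcs D u"
    then have ue: "tail D e \<rightarrow>\<^bsub>D\<^esub> u" unfolding arcs_ends_conv by force
    show "tail D e \<in> opp u" using arc_opp(2)[OF ue] .
    fix i assume "tail D e = g i" "i \<in> J"
    with ue miss show False unfolding I_def J_def by auto
  qed
  then have "in_degree D u \<le> card (opp u - g ` J)"
    unfolding deg by (intro card_mono) (auto simp: finite_opp)
  also have "\<dots> = a - card J"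
    using g(2) IJ fin by (subst card_Diff_subset) (auto simp: card_opp cg)
  finally have "in_degree D u \<le> a - card J" .
  with o cIJ a_ge rich show False
    unfolding rich_def degree_def by linarith
qed

section \<open>Short cycles cut off by a pair of arcs\<close>

lemma chord_cycle:
  assumes "1 \<le> m" "m \<le> a - 1" and u: "u \<notin> v ` {s..<s + (2 * m - 1)}"
    and "u \<rightarrow>\<^bsub>D\<^esub> v s" "v (s + (2 * m - 2)) \<rightarrow>\<^bsub>D\<^esub> u"
  shows "has_cycle_of_length D (2 * m)"
proof -
  \<comment> \<open>The cycle is \<open>u\<close> followed by 2m - 1 consecutive vertices of the
    long cycle; \<open>h\<close> returns to \<open>u\<close> at 2m.\<close>
  define h where "h i = (if 0 < i \<and> i < 2 * m then v (s + (i - 1)) else u)" for i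
  have neq_u: "v (s + l) \<noteq> u" if "l < 2 * m - 1" for l
    using that u by auto
  have "inj_on h {..<2 * m}"
  proof (rule inj_onI)
    fix i j assume ij: "i \<in> {..<2 * m}" "j \<in> {..<2 * m}" "h i = h j"
    have h_neq: "h l \<noteq> h 0" if "0 < l" "l < 2 * m" for l
      using that neq_u[of "l - 1"] by (simp add: h_def)
    show "i = j"
    proof (cases "i = 0 \<or> j = 0")
      case True
      then show ?thesis using h_neq[of i] h_neq[of j] ij by (metis lessThan_iff not_gr_zero)
    next
      case False
      then have "v (s + (i - 1)) = v (s + (j - 1))"
        using ij by (simp add: h_def)
      then have "s + (i - 1) = s + (j - 1)"
        using assms(1,2) False ij by (intro inj_onD[OF inj_on_v[of "2 * m - 1" s]]) auto
      then show ?thesis using False by (cases i; cases j) auto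
    qed
  qed
  moreover have "h i \<rightarrow>\<^bsub>D\<^esub> h (Suc i)" if i: "i < 2 * m" for i
  proof -
    consider "i = 0" | "i = 2 * m - 1" | "0 < i" "Suc i < 2 * m" using i by linarith
    then show ?thesis
    proof cases
      case 1
      then show ?thesis using assms(1,4) by (simp add: h_def)
    next
      case 2
      then have "i - 1 = 2 * m - 2" "0 < i" "\<not> Suc i < 2 * m" using assms(1) by auto
      then show ?thesis using i assms(5) by (simp add: h_def)
    next
      case 3
      then show ?thesis using v_arc[of "s + (i - 1)"] by (simp add: h_def)
    qed
  qed
  moreover have "h (2 * m) = h 0" by (simp add: h_def)
  ultimately show ?thesis
    using assms(1) by (intro has_cycle_of_lengthI[of D _ h]) (auto intro: wf_digraph)
qed

lemma rich_outside:
  assumes "rich u" "u \<notin> range v" "1 \<le> m" "m \<le> a - 1"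
  shows "has_cycle_of_length D (2 * m)"
proof -
  obtain c where c: "v c \<in> opp u" using v_Suc_opp by blast
  have "(\<lambda>i. v (c + 2 * i)) ` {..<3} \<subseteq> opp u"
    "(\<lambda>i. v (c + (2 * m - 2) + 2 * i)) ` {..<3} \<subseteq> opp u"
    using c v_even_opp[of c "m - 1" u] by (auto simp: v_even_opp v_even_opp[of "Suc _", simplified] diff_mult_distrib2)
  then obtain i where "u \<rightarrow>\<^bsub>D\<^esub> v (c + 2 * i)" "v (c + (2 * m - 2) + 2 * i) \<rightarrow>\<^bsub>D\<^esub> u"
    using rich_pair[OF assms(1) inj_on_v_even _ inj_on_v_even] by metis
  then show ?thesis
    using assms by (intro chord_cycle[of m u "c + 2 * i"]) (auto simp: ac_simps)
qed

text \<open>The segment begins \<open>s + 1\<close> places after \<open>v t\<close>; the bound on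
  \<open>s\<close> makes it end before the long cycle returns to \<open>v t\<close>.\<close>

lemma chord_cycle_on:
  assumes "1 \<le> m" "s + 2 * m \<le> 2 * a - 2" "v t \<rightarrow>\<^bsub>D\<^esub> v (t + 1 + s)" "v (t + 1 + s + (2 * m - 2)) \<rightarrow>\<^bsub>D\<^esub> v t"
  shows "has_cycle_of_length D (2 * m)"
proof (rule chord_cycle[OF assms(1) _ _ assms(3,4)])
  show "v t \<notin> v ` {t + 1 + s..<t + 1 + s + (2 * m - 1)}"
  proof
    assume "v t \<in> v ` {t + 1 + s..<t + 1 + s + (2 * m - 1)}"
    then obtain j where "j \<in> {t + 1 + s..<t + 1 + s + (2 * m - 1)}" "v t = v j" by blast
    moreover from this have "t < j" "j < t + (2 * a - 2)" using assms(1,2) by auto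
    ultimately show False using v_neq[of t j] by blast
  qed
qed (use assms in auto)

text \<open>The three pairs use the offsets 0, 2, 4 in \<open>chord_cycle_on\<close>; the largest
  one fits exactly when \<open>m + 3 \<le> a\<close>.\<close>

lemma rich_on_cycle:
  assumes "rich (v t)" "1 \<le> m" "m + 3 \<le> a"
  shows "has_cycle_of_length D (2 * m)"
proof -
  have c: "v (t + 1) \<in> opp (v t)" using arc_opp(1)[OF v_arc] by simp
  have "(\<lambda>i. v (t + 1 + 2 * i)) ` {..<3} \<subseteq> opp (v t)"
    "(\<lambda>i. v (t + 1 + (2 * m - 2) + 2 * i)) ` {..<3} \<subseteq> opp (v t)"
    using c v_even_opp[of "t + 1" "m - 1" "v t"] by (auto simp: v_even_opp v_even_opp[of "Suc _", simplified] diff_mult_distrib2)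
  then obtain i where "i < 3" "v t \<rightarrow>\<^bsub>D\<^esub> v (t + 1 + 2 * i)" "v (t + 1 + (2 * m - 2) + 2 * i) \<rightarrow>\<^bsub>D\<^esub> v t"
    using rich_pair[OF assms(1) inj_on_v_even _ inj_on_v_even] by metis
  then show ?thesis
    using assms by (intro chord_cycle_on[of m "2 * i" t]) (auto simp: ac_simps)
qed

text \<open>For length 2a - 4 only the offsets 0 and 2 fit. Both would close a forbidden cycle, so
  the pair that is present is the third one, at \<open>q\<close>.\<close>

lemma rich_on_cycle_joined:
  assumes "rich (v t)" "q \<in> opp (v t)" "q \<notin> range v" "\<not> has_cycle_of_length D (2 * (a - 2))"
  shows "v t \<rightarrow>\<^bsub>D\<^esub> q \<and> q \<rightarrow>\<^bsub>D\<^esub> v t"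
proof -
  let ?f = "\<lambda>d i. if i = (2::nat) then q else v (d + 2 * i)"
  have inj: "inj_on (?f d) {..<3}" for d
  proof (rule inj_onI)
    fix i j assume ij: "i \<in> {..<3}" "j \<in> {..<3}" "?f d i = ?f d j"
    have q: "q \<noteq> v l" for l using assms(3) by auto
    show "i = j"
    proof (cases "i = 2 \<or> j = 2")
      case True
      then show ?thesis using ij q q[symmetric] by (auto split: if_splits)
    next
      case False
      then have "d + 2 * i = d + 2 * j"
        using ij a_ge by (intro inj_onD[OF inj_on_v[of 6 d]]) auto
      then show ?thesis by simp
    qed
  qed
  have c: "v (t + 1) \<in> opp (v t)" using arc_opp(1)[OF v_arc] by simp
  have "v (t + 1 + (2 * (a - 2) - 2)) \<in> opp (v t)"
    using c v_even_opp[of "t + 1" "a - 3" "v t"] by (simp add: diff_mult_distrib2)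
  then have sub: "?f (t + 1) ` {..<3} \<subseteq> opp (v t)"
    "?f (t + 1 + (2 * (a - 2) - 2)) ` {..<3} \<subseteq> opp (v t)"
    using c assms(2) by (auto simp: v_even_opp[of "Suc _", simplified])
  obtain i where i: "i < 3" "v t \<rightarrow>\<^bsub>D\<^esub> ?f (t + 1) i" "?f (t + 1 + (2 * (a - 2) - 2)) i \<rightarrow>\<^bsub>D\<^esub> v t"
    by (rule rich_pair[OF assms(1) inj sub(1) inj sub(2)])
  show ?thesis
  proof (cases "i = 2")
    case True
    then show ?thesis using i by simp
  next
    case False
    then have "has_cycle_of_length D (2 * (a - 2))"
      using i a_ge by (intro chord_cycle_on[of "a - 2" "2 * i" t]) (auto simp: ac_simps)
    with assms(4) show ?thesis by simp
  qed
qed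

section \<open>Arcs entering the cycle and the length 2a - 4\<close>

lemma rich_predecessor:
  assumes "\<not> rich q" "q \<notin> range v" "q \<rightarrow>\<^bsub>D\<^esub> v (Suc i)"
  shows "rich (v i)"
proof -
  have "dominating_pair D q (v i)"
    unfolding dominating_pair_def using assms v_arc[of i] adj_in_verts[OF assms(3)] by auto
  from dom[OF this] assms(1) show ?thesis unfolding rich_def by auto
qed

text \<open>Positions on the cycle alternate between the parts, so the cycle covers at most a - 1 of
  the a vertices of \<open>opp u\<close>.\<close>

lemma outside_opp:
  obtains r where "r \<in> opp u" "r \<notin> range v"
proof -
  define c :: nat where "c = (if v 0 \<in> opp u then 0 else 1)"
  have "opp u \<inter> range v \<subseteq> (\<lambda>j. v (c + 2 * j)) ` {..<a - 1}"
  proof safe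
    fix i assume vi: "v i \<in> opp u"
    define k where "k = i mod (2 * a - 2)"
    have k: "k < 2 * a - 2" "v i = v k"
      using a_ge unfolding k_def v_eq_iff by auto
    have "v (k mod 2) \<in> opp u"
      using v_even_opp[of "k mod 2" "k div 2" u] vi k(2) by simp
    then have "k mod 2 = c"
      using v_Suc_opp[of 0 u] unfolding c_def by (cases "k mod 2 = 0") (auto simp: odd_iff_mod_2_eq_one)
    then have "k = c + 2 * (k div 2)" "k div 2 < a - 1"
      using k(1) by (auto simp: algebra_simps)
    then show "v i \<in> (\<lambda>j. v (c + 2 * j)) ` {..<a - 1}"
      unfolding k(2) by (metis imageI lessThan_iff)
  qed
  then have "card (opp u \<inter> range v) \<le> a - 1"
    by (metis card_lessThan finite_lessThan surj_card_le)
  then have "opp u \<inter> range v \<noteq> opp u"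
    using card_opp[of u] a_ge by auto
  then show ?thesis using that by blast
qed

lemma arc_enters_cycle:
  assumes "strongly_connected D"
  obtains q i where "q \<in> verts D" "q \<notin> range v" "q \<rightarrow>\<^bsub>D\<^esub> v i"
proof -
  obtain r where r: "r \<in> verts D" "r \<notin> range v"
    using outside_opp[of "v 0"] unfolding opp_def by blast
  have "r \<rightarrow>\<^sup>*\<^bsub>D\<^esub> v 0"
    using assms r(1) unfolding strongly_connected_def by simp
  \<comment> \<open>Invariant along a walk from \<open>r\<close>: its current end is off the cycle,
    or some arc enters the cycle. The first alternative fails at \<open>v 0\<close>.\<close>
  then have "v 0 \<notin> range v \<or> (\<exists>q i. q \<in> verts D \<and> q \<notin> range v \<and> q \<rightarrow>\<^bsub>D\<^esub> v i)"
  proof (induction rule: reachable_induct)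
    case base
    then show ?case using r by blast
  next
    case (step x y)
    then show ?case using adj_in_verts by blast
  qed
  then show ?thesis using that by blast
qed

lemma missing_length_absurd:
  assumes "\<not> has_cycle_of_length D (2 * (a - 2))"
    and q: "q \<in> verts D" "q \<notin> range v" "q \<rightarrow>\<^bsub>D\<^esub> v i"
  shows False
proof -
  have poor: "\<not> rich z" if "z \<notin> range v" for z
  proof -
    have "1 \<le> a - 2" "a - 2 \<le> a - 1" using a_ge by auto
    then show ?thesis using rich_outside[OF _ that] assms(1) by blast
  qed
  obtain r where r: "r \<in> opp q" "r \<notin> range v"
    using outside_opp by blast
  \<comment> \<open>Two backward steps: \<open>v (Suc j)\<close> is rich, hence joined to
    \<open>r\<close>; then \<open>r\<close> dominates it, so \<open>v j\<close> is rich and joined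
    to \<open>q\<close>.\<close>
  have step2: "v j \<rightarrow>\<^bsub>D\<^esub> q \<and> q \<rightarrow>\<^bsub>D\<^esub> v j" if "q \<rightarrow>\<^bsub>D\<^esub> v (Suc (Suc j))" for j
  proof -
    have "v (Suc (Suc j)) \<in> opp q" using arc_opp(1)[OF that] .
    then have nj: "v (Suc j) \<notin> opp q" and j: "v j \<in> opp q"
      by (auto simp: v_Suc_opp)
    have "r \<in> opp (v (Suc j))" using r(1) nj unfolding opp_def by auto
    then have "r \<rightarrow>\<^bsub>D\<^esub> v (Suc j)"
      using rich_on_cycle_joined[OF rich_predecessor[OF poor[OF q(2)] q(2) that] _ r(2) assms(1)] by simp
    then have "rich (v j)" by (rule rich_predecessor[OF poor[OF r(2)] r(2)])
    moreover have "q \<in> opp (v j)" using j q(1) unfolding opp_def by auto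
    ultimately show ?thesis
      using rich_on_cycle_joined[OF _ _ q(2) assms(1)] by simp
  qed
  \<comment> \<open>Adding one period keeps the subtractions below from being truncated.\<close>
  define I where "I = i + (2 * a - 2)"
  have "v I = v i" unfolding v_eq_iff I_def by simp
  have all: "v (I - 2 * Suc t) \<rightarrow>\<^bsub>D\<^esub> q \<and> q \<rightarrow>\<^bsub>D\<^esub> v (I - 2 * Suc t)" if "Suc t \<le> a - 1" for t
    using that
  proof (induction t)
    case 0
    have "Suc (Suc (I - 2)) = I" using a_ge unfolding I_def by simp
    then show ?case using step2[of "I - 2"] q(3) \<open>v I = v i\<close> by simp
  next
    case (Suc t)
    have "Suc (Suc (I - 2 * Suc (Suc t))) = I - 2 * Suc t" using Suc.prems unfolding I_def by simp
    then show ?case using step2[of "I - 2 * Suc (Suc t)"] Suc by simp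
  qed
  \<comment> \<open>The segment from I - 2(a - 2) to I - 2 has 2a - 5 vertices; \<open>q\<close>
    completes it to length 2a - 4.\<close>
  have *: "I - 2 * Suc (a - 3) + (2 * (a - 2) - 2) = I - 2 * Suc 0"
    using a_ge unfolding I_def by simp
  have "v (I - 2 * Suc (a - 3) + (2 * (a - 2) - 2)) \<rightarrow>\<^bsub>D\<^esub> q"
    unfolding * using all[of 0] a_ge by simp
  moreover have "q \<rightarrow>\<^bsub>D\<^esub> v (I - 2 * Suc (a - 3))"
    using all[of "a - 3"] a_ge by simp
  moreover have "1 \<le> a - 2" "a - 2 \<le> a - 1" using a_ge by auto
  ultimately show False
    using assms(1) chord_cycle[of "a - 2" q "I - 2 * Suc (a - 3)"] q(2) by blast
qed

end

theorem theorem1p9: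
  fixes D :: "('a, 'b) pre_digraph" and X Y :: "'a set" and a :: nat
  assumes "digraph D"
    and "strongly_connected D"
    and "balanced_bipartition D X Y"
    and "card (verts D) = 2 * a"
    and "2 * a \<ge> 8"
    and "has_cycle_of_length D (2 * a - 2)"
    and "\<And>x y. dominating_pair D x y \<Longrightarrow> max (degree D x) (degree D y) \<ge> 2 * a - 2"
  shows "\<forall>k. 1 \<le> k \<and> k \<le> a - 1 \<longrightarrow> has_cycle_of_length D (2 * k)"
proof (intro allI impI, elim conjE)
  fix k assume k: "1 \<le> k" "k \<le> a - 1"
  interpret digraph D by fact
  obtain v where v: "\<And>i. v i \<rightarrow>\<^bsub>D\<^esub> v (Suc i)"
      "\<And>i j. v i = v j \<longleftrightarrow> i mod (2 * a - 2) = j mod (2 * a - 2)"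
    using has_cycle_of_lengthE[OF wf_digraph assms(6)] by metis
  interpret bipartite_with_cycle D X Y a v
    using assms v by unfold_locales auto
  obtain q i where q: "q \<in> verts D" "q \<notin> range v" "q \<rightarrow>\<^bsub>D\<^esub> v i"
    using arc_enters_cycle[OF assms(2)] by metis
  consider "k = a - 1" | "k = a - 2" | "k + 3 \<le> a" using k by linarith
  then show "has_cycle_of_length D (2 * k)"
  proof cases
    case 1
    then show ?thesis using assms(6) by (simp add: diff_mult_distrib2)
  next
    case 2
    then show ?thesis using missing_length_absurd[OF _ q] by blast
  next
    case 3
    show ?thesis
    \<comment> \<open>The head of the entering arc is dominated by \<open>q\<close> and by its
      predecessor on the cycle, so one of these two is rich.\<close>
    proof (cases "rich q")
      case True
      then show ?thesis using rich_outside q k by blast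
    next
      case False
      \<comment> \<open>This index stands for i - 1 modulo the period and also covers
        \<open>i = 0\<close>.\<close>
      have "v (Suc (i + (2 * a - 3))) = v i"
      proof -
        have "Suc (i + (2 * a - 3)) = i + (2 * a - 2)" using assms(5) by simp
        then show ?thesis unfolding v_eq_iff by (metis mod_add_self2)
      qed
      then have "rich (v (i + (2 * a - 3)))"
        using rich_predecessor[OF False q(2)] q(3) by metis
      then show ?thesis using rich_on_cycle k 3 by blast
    qed
  qed
qed

end
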